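(* Let $k,d,q \in \mathbb{N}$ satisfy $d \ge k \cdot (4q)^{4k\log k}$. Then there exists a scheme $\beta$ for $T_{k,d}$ such that for every $q$-subset $A \subseteq L(T_{k,d})$ there is a collision with respect to $(A,\beta)$.
   Context: $\log$ denotes the base-2 logarithm. $T_{k,d}$ is the full $k$-ary rooted tree of depth $d$ (root of depth $0$, $k^d$ leaves at depth $d$). $L(T)$ is the set of leaves of a rooted tree $T$, $T^v_{k,d}$ is the subtree of $T_{k,d}$ rooted at $v$, and $\mathsf{Children}(v)$ is the set of children of $v$. A subset $A\subseteq L(T_{k,d})$ is a $q$-subset if $|A|\ge k^d/q$. A scheme for $T_{k,d}$ is a collection $\beta=(f_v)_{v\in V(T_{k,d})}$ where each $f_v$ is a bijection from $L(T^v_{k,d})$ to $\{1,\dots,|L(T^v_{k,d})|\}$. A node $u\in V(T_{k,d})$ forms a collision with respect to $(A,\beta)$ if $A$ contains elements $a_1,\dots,a_k$ such that for each $i\in[k]$, $a_i$ is a descendant of $u_i\in\mathsf{Children}(u)$ where $u_1,\dots,u_k$ are distinct, and $f_{u_1}(a_1)=\dots=f_{u_k}(a_k)$; there is a collision with respect to $(A,\beta)$ if some node forms one. *)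

theory Defs
  imports Complex_Main "HOL-Library.Sublist"
begin

text \<open>Nodes of a rooted tree are the words spelling the path from the root \<open>[]\<close>;
  a tree is a prefix-closed set of words, or the part of such a set lying below a node.\<close>

type_synonym node = "nat list"

definition full_tree :: "nat \<Rightarrow> nat \<Rightarrow> node set" where
  "full_tree k d = {v. set v \<subseteq> {..<k} \<and> length v \<le> d}"

definition subtree :: "node set \<Rightarrow> node \<Rightarrow> node set" where
  "subtree T v = {w \<in> T. prefix v w}"

definition children :: "node set \<Rightarrow> node \<Rightarrow> node set" where
  "children T v = {w \<in> T. \<exists>i. w = v @ [i]}"

definition leaves :: "node set \<Rightarrow> node set" where
  "leaves T = {v \<in> T. children T v = {}}"

definition scheme :: "nat \<Rightarrow> nat \<Rightarrow> (node \<Rightarrow> node \<Rightarrow> nat) \<Rightarrow> bool" where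
  "scheme k d \<beta> \<longleftrightarrow>
     (\<forall>v \<in> full_tree k d.
        bij_betw (\<beta> v) (leaves (subtree (full_tree k d) v))
          {1..card (leaves (subtree (full_tree k d) v))})"

definition q_subset :: "nat \<Rightarrow> nat \<Rightarrow> nat \<Rightarrow> node set \<Rightarrow> bool" where
  "q_subset k d q A \<longleftrightarrow>
     A \<subseteq> leaves (full_tree k d) \<and> real (card A) \<ge> real k ^ d / real q"

text \<open>A node counts as its own descendant, so that the children of a node at depth
  \<open>d - 1\<close> (which are leaves) can take part in a collision.\<close>

definition forms_collision ::
  "nat \<Rightarrow> nat \<Rightarrow> node set \<Rightarrow> (node \<Rightarrow> node \<Rightarrow> nat) \<Rightarrow> node \<Rightarrow> bool" where
  "forms_collision k d A \<beta> u \<longleftrightarrow>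
     (\<exists>a c. (\<forall>i \<in> {1..k}. a i \<in> A \<and> c i \<in> children (full_tree k d) u \<and> prefix (c i) (a i)) \<and>
            inj_on c {1..k} \<and>
            (\<forall>i \<in> {1..k}. \<forall>j \<in> {1..k}. \<beta> (c i) (a i) = \<beta> (c j) (a j)))"

definition has_collision ::
  "nat \<Rightarrow> nat \<Rightarrow> node set \<Rightarrow> (node \<Rightarrow> node \<Rightarrow> nat) \<Rightarrow> bool" where
  "has_collision k d A \<beta> \<longleftrightarrow> (\<exists>u \<in> full_tree k d. forms_collision k d A \<beta> u)"

lemma leaves_full_tree:
  assumes "k \<ge> 1"
  shows "leaves (full_tree k d) = {v. set v \<subseteq> {..<k} \<and> length v = d}"
proof -
  have "children (full_tree k d) v = {} \<longleftrightarrow> length v = d" if "v \<in> full_tree k d" for v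
  proof
    assume "children (full_tree k d) v = {}"
    then have "v @ [0] \<notin> full_tree k d" by (auto simp: children_def)
    then show "length v = d" using that assms by (auto simp: full_tree_def)
  qed (auto simp: children_def full_tree_def)
  then show ?thesis by (auto simp: leaves_def full_tree_def)
qed

lemma card_leaves_full_tree:
  assumes "k \<ge> 1"
  shows "card (leaves (full_tree k d)) = k ^ d"
  using card_lists_length_eq[of "{..<k}" d] by (simp add: leaves_full_tree[OF assms])

lemma leaves_subtree_full_tree:
  "leaves (subtree (full_tree k d) v) = {w \<in> leaves (full_tree k d). prefix v w}"
proof -
  have "children (subtree (full_tree k d) v) w = children (full_tree k d) w" if "prefix v w" for w
    using that by (auto simp: children_def subtree_def)
  then show ?thesis by (auto simp: leaves_def subtree_def)
qed

end

theory Submission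
  imports Defs "HOL-Combinatorics.Permutations" "HOL-Library.FuncSet"
begin

text \<open>Write \<open>N = k\<^sup>d\<close>. By induction on \<open>d\<close> there is a scheme for which the sum of
  \<open>exp (N ((4k + d)/k \<mu>\<^sup>k - 5))\<close> over all collision-free \<open>A\<close>, of density \<open>\<mu> = |A|/N\<close>, is at
  most 1. In the step all subtrees at the children of the root carry the same scheme, and the
  labellings at these children are composed with random permutations: sets of densities
  \<open>\<mu>\<^sub>1, \<dots>, \<mu>\<^sub>k\<close> then have no common label with probability at most
  \<open>(1 - \<Prod>\<mu>\<^sub>i)\<^sup>N \<le> exp (- N \<Prod>\<mu>\<^sub>i)\<close>, and the inequality
  \<open>(c + 1) \<mu>\<^sup>k \<le> c/k \<Sum>\<mu>\<^sub>i\<^sup>k + \<Prod>\<mu>\<^sub>i\<close> for the mean \<open>\<mu>\<close> of the \<open>\<mu>\<^sub>i\<close> and \<open>c \<ge> 4k\<close> closes the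
  induction. If \<open>\<mu> \<ge> 1/q\<close> and \<open>d \<ge> 5 k q\<^sup>k\<close>, the exponent is positive, so \<open>A\<close> cannot be
  collision-free.\<close>

section \<open>Real inequalities for powers, exponentials and products\<close>

text \<open>Bernoulli's inequality with a quadratic gain, which later measures the spread around a
  mean. The induction step discards \<open>y\<^sup>2 * (n + y)\<close>, nonnegative since
  \<open>n \<ge> 2\<close> and \<open>y \<ge> -1\<close>.\<close>

lemma power_quadratic_lower_bound:
  fixes y :: real
  assumes "n \<ge> 2" "y \<ge> -1"
  shows "1 + n * y + y\<^sup>2 \<le> (1 + y) ^ n"
  using assms(1)
proof (induction n rule: dec_induct)
  case base
  then show ?case by (simp add: power2_eq_square algebra_simps)
next
  case (step n)
  have "0 \<le> y\<^sup>2 * (n + y)" using step assms(2) by simp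
  then have "1 + Suc n * y + y\<^sup>2 \<le> (1 + n * y + y\<^sup>2) * (1 + y)"
    by (simp add: power2_eq_square algebra_simps)
  also have "\<dots> \<le> (1 + y) ^ n * (1 + y)"
    using step.IH assms(2) by (intro mult_right_mono) auto
  finally show ?case by (simp add: mult.commute)
qed

text \<open>Multiplied over factors whose deviations \<open>y\<close> sum to zero, this bound loses
  its linear parts and keeps only the squares. Bounds on the logarithm give it for
  \<open>y < 1\<close>; for \<open>y \<ge> 1\<close> the exponent is negative.\<close>

lemma exp_le_one_plus:
  fixes y :: real
  assumes "y \<ge> -1/2"
  shows "exp (y - 2 * y\<^sup>2) \<le> 1 + y"
proof -
  have "y - 2 * y\<^sup>2 \<le> ln (1 + y)"
  proof -
    consider "y \<ge> 1" | "0 \<le> y" "y < 1" | "y < 0" by linarith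
    then show ?thesis
    proof cases
      case 1
      then have "y * 1 \<le> y * y" by (intro mult_left_mono) auto
      moreover have "0 \<le> ln (1 + y)" using 1 by simp
      ultimately show ?thesis using 1 unfolding power2_eq_square by linarith
    next
      case 2
      then have "y - y\<^sup>2 \<le> ln (1 + y)" by (intro ln_one_plus_pos_lower_bound) auto
      then show ?thesis using zero_le_power2[of y] by linarith
    next
      case 3
      then show ?thesis using ln_one_minus_pos_lower_bound[of "-y"] assms by simp
    qed
  qed
  then show ?thesis using assms by (subst (asm) ln_ge_iff) auto
qed

text \<open>A factor below \<open>1/2\<close> alone contributes at least \<open>1/4\<close> to the
  sum of squares, so the left side is at most 0; this fixes the constant 4. Otherwise
  \<open>exp_le_one_plus\<close> applies to every factor and gives even the constant 2.\<close>

lemma prod_ge_one_minus_variance: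
  fixes x :: "'a \<Rightarrow> real"
  assumes "finite I" "\<And>i. i \<in> I \<Longrightarrow> 0 \<le> x i" "(\<Sum>i\<in>I. x i - 1) = 0"
  shows "1 - 4 * (\<Sum>i\<in>I. (x i - 1)\<^sup>2) \<le> (\<Prod>i\<in>I. x i)"
proof (cases "\<exists>i\<in>I. x i < 1/2")
  case True
  then obtain i where i: "i \<in> I" "x i < 1/2" by blast
  have "(1/2)\<^sup>2 \<le> (1 - x i)\<^sup>2" using i by (intro power_mono) auto
  also have "\<dots> = (x i - 1)\<^sup>2" by (simp add: power2_commute)
  also have "\<dots> \<le> (\<Sum>i\<in>I. (x i - 1)\<^sup>2)"
    using assms(1) i(1) by (intro member_le_sum) auto
  finally have "1 - 4 * (\<Sum>i\<in>I. (x i - 1)\<^sup>2) \<le> 0" by (simp add: power2_eq_square)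
  also have "0 \<le> (\<Prod>i\<in>I. x i)" using assms(2) by (intro prod_nonneg) auto
  finally show ?thesis .
next
  case False
  have "1 - 4 * (\<Sum>i\<in>I. (x i - 1)\<^sup>2) \<le> 1 + (- 2 * (\<Sum>i\<in>I. (x i - 1)\<^sup>2))"
    by (simp add: sum_nonneg)
  also have "\<dots> \<le> exp (- 2 * (\<Sum>i\<in>I. (x i - 1)\<^sup>2))" by (rule exp_ge_add_one_self)
  also have "\<dots> = exp (\<Sum>i\<in>I. (x i - 1) - 2 * (x i - 1)\<^sup>2)"
    unfolding sum_subtractf[of "\<lambda>i. x i - 1"] assms(3) by (simp add: sum_distrib_left sum_negf)
  also have "\<dots> = (\<Prod>i\<in>I. exp ((x i - 1) - 2 * (x i - 1)\<^sup>2))" by (rule exp_sum[OF assms(1)])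
  also have "\<dots> \<le> (\<Prod>i\<in>I. x i)"
  proof (intro prod_mono conjI)
    fix i assume "i \<in> I"
    then show "exp ((x i - 1) - 2 * (x i - 1)\<^sup>2) \<le> x i"
      using False exp_le_one_plus[of "x i - 1"] by force
  qed simp
  finally show ?thesis .
qed

text \<open>The failure of equality in the power mean inequality pays for a small product.\<close>

lemma power_mean_plus_prod:
  fixes x :: "nat \<Rightarrow> real" and c :: real
  assumes k: "k \<ge> 2" and c: "c \<ge> 4 * k" and x: "\<And>i. i < k \<Longrightarrow> 0 \<le> x i"
    and m: "k * m = (\<Sum>i<k. x i)"
  shows "(c + 1) * m ^ k \<le> c / k * (\<Sum>i<k. x i ^ k) + (\<Prod>i<k. x i)"
proof (cases "m = 0")
  case True
  have "0 \<le> c / k * (\<Sum>i<k. x i ^ k) + (\<Prod>i<k. x i)"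
    using x c k by (intro add_nonneg_nonneg mult_nonneg_nonneg sum_nonneg prod_nonneg) auto
  then show ?thesis using True k by (simp add: power_0_left)
next
  case False
  have "0 \<le> k * m" unfolding m using x by (intro sum_nonneg) auto
  then have mpos: "m > 0" using False k by (simp add: zero_le_mult_iff)
  \<comment> \<open>Both sides are homogeneous of degree \<open>k\<close>, so dividing by
    \<open>m\<close> reduces the claim to mean one.\<close>
  define z where "z i = x i / m" for i
  have z: "0 \<le> z i" if "i < k" for i using x[OF that] mpos by (simp add: z_def)
  have zsum: "(\<Sum>i<k. z i - 1) = 0"
    using m[symmetric] mpos by (simp add: z_def sum_subtractf flip: sum_divide_distrib)
  define s where "s = (\<Sum>i<k. (z i - 1)\<^sup>2)"
  have "s \<ge> 0" by (simp add: s_def sum_nonneg)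
  have "k + s = (\<Sum>i<k. 1 + k * (z i - 1) + (z i - 1)\<^sup>2)"
    unfolding s_def sum.distrib sum_distrib_left[symmetric] zsum by simp
  also have "\<dots> \<le> (\<Sum>i<k. z i ^ k)"
  proof (intro sum_mono)
    fix i assume "i \<in> {..<k}"
    then show "1 + k * (z i - 1) + (z i - 1)\<^sup>2 \<le> z i ^ k"
      using power_quadratic_lower_bound[OF k, of "z i - 1"] z[of i] by simp
  qed
  finally have "c / k * (k + s) \<le> c / k * (\<Sum>i<k. z i ^ k)"
    using c k by (intro mult_left_mono) auto
  \<comment> \<open>Here \<open>c \<ge> 4 * k\<close> lets the gain of the power sum cover the loss
    \<open>4 * s\<close> of the product.\<close>
  moreover have "4 * s \<le> c / k * s"
    using c k \<open>s \<ge> 0\<close> by (intro mult_right_mono) (auto simp: field_simps)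
  moreover have "c / k * (k + s) = c + c / k * s" using k by (simp add: field_simps)
  moreover have "1 - 4 * s \<le> (\<Prod>i<k. z i)"
    unfolding s_def using z zsum by (intro prod_ge_one_minus_variance) auto
  ultimately have "c + 1 \<le> c / k * (\<Sum>i<k. z i ^ k) + (\<Prod>i<k. z i)" by linarith
  then have "(c + 1) * m ^ k \<le> (c / k * (\<Sum>i<k. z i ^ k) + (\<Prod>i<k. z i)) * m ^ k"
    using mpos by (intro mult_right_mono) auto
  also have "\<dots> = c / k * (\<Sum>i<k. (z i * m) ^ k) + (\<Prod>i<k. z i * m)"
    by (simp add: power_mult_distrib prod.distrib sum_distrib_right distrib_right mult.assoc)
  also have "\<dots> = c / k * (\<Sum>i<k. x i ^ k) + (\<Prod>i<k. x i)"
    using mpos by (simp add: z_def)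
  finally show ?thesis .
qed

section \<open>Images of sets under random permutations\<close>

text \<open>Negative correlation: among the permutations whose image of \<open>A\<close> misses
  \<open>R\<close>, all points of \<open>S - R\<close> are hit equally often, so each with frequency
  \<open>card A / card (S - R)\<close>, which is at least \<open>card A / card S\<close>. Every
  point added to \<open>R\<close> therefore costs a factor of at most
  \<open>1 - card A / card S\<close>.\<close>

lemma card_permutations_avoiding:
  assumes "finite S" "A \<subseteq> S" "R \<subseteq> S" "S \<noteq> {}"
  shows "real (card {p. p permutes S \<and> p ` A \<inter> R = {}})
    \<le> fact (card S) * (1 - card A / card S) ^ card R"
  using finite_subset[OF assms(3,1)] assms(3)
proof (induction R rule: finite_induct)
  case empty
  then show ?case using card_permutations[OF refl assms(1)] by simp
next
  case (insert x R)
  define P where "P R = {p. p permutes S \<and> p ` A \<inter> R = {}}" for R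
  define c where "c y = card {p \<in> P R. y \<in> p ` A}" for y
  have fin: "finite (P R)" for R
    using finite_permutations[OF assms(1)] by (rule rev_finite_subset) (auto simp: P_def)
  have N: "card S > 0" using assms by (simp add: card_gt_0_iff)
  \<comment> \<open>Composing with the transposition of \<open>y\<close> and \<open>z\<close> keeps
    the image of \<open>A\<close> off \<open>R\<close> and turns a hit at \<open>y\<close> into a
    hit at \<open>z\<close>.\<close>
  have c_le: "c y \<le> c z" if "y \<in> S - R" "z \<in> S - R" for y z
    unfolding c_def
  proof (rule card_inj_on_le[where f = "\<lambda>p. transpose y z \<circ> p"])
    show "inj_on (\<lambda>p. transpose y z \<circ> p) {p \<in> P R. y \<in> p ` A}"
      by (intro inj_onI) (metis comp_assoc comp_id fun.map_id0 id_apply transpose_comp_involutory)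
    show "(\<lambda>p. transpose y z \<circ> p) ` {p \<in> P R. y \<in> p ` A} \<subseteq> {p \<in> P R. z \<in> p ` A}"
    proof safe
      fix p a assume p: "p \<in> P R" and a: "a \<in> A" "y = p a"
      have "transpose y z \<circ> p permutes S"
        using p that by (intro permutes_compose permutes_swap_id) (auto simp: P_def)
      moreover have "transpose y z (p b) \<notin> R" if "b \<in> A" for b
        using p that \<open>y \<in> S - R\<close> \<open>z \<in> S - R\<close> by (auto simp: P_def transpose_def)
      ultimately show "transpose (p a) z \<circ> p \<in> P R" using a by (auto simp: P_def)
      show "z \<in> (transpose (p a) z \<circ> p) ` A" using a by (auto intro!: image_eqI[of _ _ a])
    qed
  qed (use fin in auto)
  have c_eq: "c y = c x" if "y \<in> S - R" for y
    using c_le[of x y] c_le[of y x] that insert by force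
  \<comment> \<open>Double counting of pairs of a permutation in \<open>P R\<close> and a point of
    its image of \<open>A\<close>.\<close>
  have "card (P R) * card A = (\<Sum>p\<in>P R. card {y \<in> S - R. y \<in> p ` A})"
  proof (subst sum.cong[OF refl, of _ _ "\<lambda>_. card A"])
    fix p assume "p \<in> P R"
    then have p: "p permutes S" "p ` A \<inter> R = {}" by (auto simp: P_def)
    have "{y \<in> S - R. y \<in> p ` A} = p ` A"
      using p assms(2) permutes_in_image[OF p(1)] by auto
    then show "card {y \<in> S - R. y \<in> p ` A} = card A"
      using permutes_inj_on[OF p(1)] by (simp add: card_image)
  qed simp
  also have "\<dots> = (\<Sum>y\<in>S - R. c y)"
    unfolding c_def using fin assms(1) by (intro sum_multicount_gen) auto
  also have "\<dots> = card (S - R) * c x" using c_eq by simp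
  also have "\<dots> \<le> card S * c x" using assms(1) by (intro mult_right_mono card_mono) auto
  finally have "real (card (P R)) * card A \<le> card S * real (c x)"
    by (metis of_nat_le_iff of_nat_mult)
  then have cx: "card (P R) * (card A / card S) \<le> real (c x)" using N by (simp add: field_simps)
  have "P R = P (insert x R) \<union> {p \<in> P R. x \<in> p ` A}" by (auto simp: P_def)
  moreover have "P (insert x R) \<inter> {p \<in> P R. x \<in> p ` A} = {}" by (auto simp: P_def)
  ultimately have "card (P R) = card (P (insert x R)) + c x"
    unfolding c_def using fin by (metis card_Un_disjoint finite_Un)
  then have "real (card (P (insert x R))) \<le> card (P R) * (1 - card A / card S)"
    using cx by (simp add: algebra_simps)
  also have "\<dots> \<le> (fact (card S) * (1 - card A / card S) ^ card R) * (1 - card A / card S)"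
    using insert N card_mono[OF assms(1,2)] by (intro mult_right_mono) (auto simp: P_def)
  finally show ?case using insert by (simp add: P_def mult_ac)
qed

text \<open>The size of a hypergeometric intersection has a smaller generating function than
  the binomial variable of the same mean.\<close>

lemma sum_permutations_power_card_Int:
  fixes t :: real
  assumes "finite S" "A \<subseteq> S" "B \<subseteq> S" "S \<noteq> {}" "0 \<le> t" "t \<le> 1"
  shows "(\<Sum>p | p permutes S. t ^ card (B \<inter> p ` A))
    \<le> fact (card S) * (1 - (1 - t) * (card A / card S)) ^ card B"
proof -
  have finB: "finite B" using assms finite_subset by blast
  define \<mu> where "\<mu> = card A / card S"
  \<comment> \<open>Each factor is split into \<open>t\<close> plus a term that vanishes on the
    image of \<open>A\<close>. Expanding leaves nonnegative multiples of avoidance indicators, so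
    upper bounds on avoidance suffice.\<close>
  have "t ^ card (B \<inter> p ` A)
      = (\<Sum>R\<in>Pow B. (1 - t) ^ card R * t ^ card (B - R) * of_bool (p ` A \<inter> R = {}))"
    for p :: "'a \<Rightarrow> 'a"
  proof -
    have "t ^ card (B \<inter> p ` A) = (\<Prod>j\<in>B. if j \<in> p ` A then t else 1)"
      using finB by (simp add: prod.If_cases Int_def)
    also have "\<dots> = (\<Prod>j\<in>B. (if j \<in> p ` A then 0 else 1 - t) + t)"
      by (intro prod.cong) auto
    also have "\<dots> = (\<Sum>R\<in>Pow B. (\<Prod>j\<in>R. if j \<in> p ` A then 0 else 1 - t) * (\<Prod>j\<in>B - R. t))"
      by (rule prod_add[OF finB])
    also have "\<dots> = (\<Sum>R\<in>Pow B. (1 - t) ^ card R * t ^ card (B - R) * of_bool (p ` A \<inter> R = {}))"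
    proof (intro sum.cong refl)
      fix R assume "R \<in> Pow B"
      then have "finite R" using finB finite_subset by auto
      have "(\<Prod>j\<in>R. if j \<in> p ` A then 0 else 1 - t) = (1 - t) ^ card R * of_bool (p ` A \<inter> R = {})"
      proof (cases "p ` A \<inter> R = {}")
        case True
        then have "(\<Prod>j\<in>R. if j \<in> p ` A then 0 else 1 - t) = (\<Prod>j\<in>R. 1 - t)"
          by (intro prod.cong) auto
        then show ?thesis using True by simp
      next
        case False
        then show ?thesis using \<open>finite R\<close> by (auto intro!: prod_zero)
      qed
      then show "(\<Prod>j\<in>R. if j \<in> p ` A then 0 else 1 - t) * (\<Prod>j\<in>B - R. t)
          = (1 - t) ^ card R * t ^ card (B - R) * of_bool (p ` A \<inter> R = {})" by simp
    qed
    finally show ?thesis .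
  qed
  then have "(\<Sum>p | p permutes S. t ^ card (B \<inter> p ` A))
      = (\<Sum>p | p permutes S. \<Sum>R\<in>Pow B.
          (1 - t) ^ card R * t ^ card (B - R) * of_bool (p ` A \<inter> R = {}))" by simp
  also have "\<dots> = (\<Sum>R\<in>Pow B. \<Sum>p | p permutes S.
          (1 - t) ^ card R * t ^ card (B - R) * of_bool (p ` A \<inter> R = {}))"
    by (rule sum.swap)
  also have "\<dots> = (\<Sum>R\<in>Pow B. (1 - t) ^ card R * t ^ card (B - R)
      * card {p. p permutes S \<and> p ` A \<inter> R = {}})"
    using finite_permutations[OF assms(1)]
    by (simp add: sum_distrib_left[symmetric] Int_def)
  also have "\<dots> \<le> (\<Sum>R\<in>Pow B. (1 - t) ^ card R * t ^ card (B - R)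
      * (fact (card S) * (1 - \<mu>) ^ card R))"
    unfolding \<mu>_def using assms by (intro sum_mono mult_left_mono card_permutations_avoiding) auto
  also have "\<dots> = fact (card S)
      * (\<Sum>R\<in>Pow B. (\<Prod>j\<in>R. (1 - t) * (1 - \<mu>)) * (\<Prod>j\<in>B - R. t))"
    by (simp add: sum_distrib_left power_mult_distrib mult_ac)
  \<comment> \<open>The same expansion read backwards, with \<open>1 - \<mu>\<close> in place of the
    indicator at each point.\<close>
  also have "\<dots> = fact (card S) * (\<Prod>j\<in>B. (1 - t) * (1 - \<mu>) + t)"
    by (simp only: prod_add[OF finB])
  also have "\<dots> = fact (card S) * (1 - (1 - t) * \<mu>) ^ card B"
    by (simp add: algebra_simps)
  finally show ?thesis by (simp add: \<mu>_def)
qed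

text \<open>First moment argument: the whole weighted sum is averaged over the permutations, so a
  single \<open>p\<close> serves all of \<open>F\<close> at once.\<close>

lemma ex_permutation_below_average:
  fixes w t :: "'b \<Rightarrow> real" and S :: "'a set"
  assumes "finite S" "S \<noteq> {}"
    and "\<And>a. a \<in> F \<Longrightarrow> 0 \<le> w a" "\<And>a. a \<in> F \<Longrightarrow> 0 \<le> t a" "\<And>a. a \<in> F \<Longrightarrow> t a \<le> 1"
    and "\<And>a. a \<in> F \<Longrightarrow> A a \<subseteq> S" "\<And>a. a \<in> F \<Longrightarrow> B a \<subseteq> S"
  obtains p where "p permutes S"
    "(\<Sum>a\<in>F. w a * t a ^ card (B a \<inter> p ` A a))
      \<le> (\<Sum>a\<in>F. w a * (1 - (1 - t a) * (card (A a) / card S)) ^ card (B a))"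
proof (rule ccontr)
  let ?r = "\<Sum>a\<in>F. w a * (1 - (1 - t a) * (card (A a) / card S)) ^ card (B a)"
  assume "\<not> thesis"
  then have less: "?r < (\<Sum>a\<in>F. w a * t a ^ card (B a \<inter> p ` A a))" if "p permutes S" for p
    using that that[THEN \<open>\<And>p. _ \<Longrightarrow> _ \<Longrightarrow> thesis\<close>] by force
  have "fact (card S) * ?r = (\<Sum>p | p permutes S. ?r)"
    using card_permutations[OF refl assms(1)] by simp
  also have "\<dots> < (\<Sum>p | p permutes S. \<Sum>a\<in>F. w a * t a ^ card (B a \<inter> p ` A a))"
  proof (rule sum_strict_mono)
    show "{p. p permutes S} \<noteq> {}" using permutes_id[of S] by blast
  qed (use less finite_permutations[OF assms(1)] in auto)
  also have "\<dots> = (\<Sum>a\<in>F. w a * (\<Sum>p | p permutes S. t a ^ card (B a \<inter> p ` A a)))"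
    by (subst sum.swap) (simp add: sum_distrib_left)
  also have "\<dots> \<le> (\<Sum>a\<in>F. w a * (fact (card S)
      * (1 - (1 - t a) * (card (A a) / card S)) ^ card (B a)))"
    using assms by (intro sum_mono mult_left_mono sum_permutations_power_card_Int) auto
  also have "\<dots> = fact (card S) * ?r" by (simp add: sum_distrib_left mult_ac)
  finally show False by simp
qed

text \<open>The permutations are fixed one at a time; the base \<open>1 - (\<Prod>i=j..<k. \<dots>)\<close> is the
  conditional estimate for the permutations still to be chosen.\<close>

lemma ex_permutations_few_disjoint:
  fixes w :: "'b \<Rightarrow> real" and S :: "'a set" and A :: "'b \<Rightarrow> nat \<Rightarrow> 'a set"
  assumes "finite S" "S \<noteq> {}"
    and "\<And>a. a \<in> F \<Longrightarrow> 0 \<le> w a" "\<And>a i. a \<in> F \<Longrightarrow> i < k \<Longrightarrow> A a i \<subseteq> S"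
    and "finite F"
  shows "\<exists>p. (\<forall>i<k. p i permutes S) \<and>
    (\<Sum>a | a \<in> F \<and> {y \<in> S. \<forall>i<k. y \<in> p i ` A a i} = {}. w a)
      \<le> (\<Sum>a\<in>F. w a * (1 - (\<Prod>i<k. card (A a i) / card S)) ^ card S)"
proof -
  define \<mu> where "\<mu> a i = card (A a i) / card S" for a i
  have \<mu>: "0 \<le> \<mu> a i" "\<mu> a i \<le> 1" if "a \<in> F" "i < k" for a i
    using card_mono[OF assms(1) assms(4)[OF that]] assms(1,2)
    by (auto simp: \<mu>_def divide_le_eq card_gt_0_iff)
  define B where "B p j a = {y \<in> S. \<forall>i<j. y \<in> p i ` A a i}"
    for p :: "nat \<Rightarrow> 'a \<Rightarrow> 'a" and j a
  have "\<exists>p. (\<forall>i<j. p i permutes S) \<and>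
      (\<Sum>a\<in>F. w a * (1 - (\<Prod>i\<in>{j..<k}. \<mu> a i)) ^ card (B p j a))
        \<le> (\<Sum>a\<in>F. w a * (1 - (\<Prod>i<k. \<mu> a i)) ^ card S)" if "j \<le> k" for j
    using that
  proof (induction j)
    case 0
    then show ?case by (simp add: B_def atLeast0LessThan)
  next
    case (Suc j)
    then obtain p where p: "\<forall>i<j. p i permutes S"
      "(\<Sum>a\<in>F. w a * (1 - (\<Prod>i\<in>{j..<k}. \<mu> a i)) ^ card (B p j a))
        \<le> (\<Sum>a\<in>F. w a * (1 - (\<Prod>i<k. \<mu> a i)) ^ card S)" by auto
    \<comment> \<open>With this \<open>t\<close> the average over the next permutation has base
      \<open>1 - (1 - t a) * \<mu> a j\<close>, which is the base of the invariant at
      \<open>j\<close>.\<close>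
    define t where "t a = 1 - (\<Prod>i\<in>{Suc j..<k}. \<mu> a i)" for a
    have t: "0 \<le> t a" "t a \<le> 1" if "a \<in> F" for a
      using \<mu> that by (auto simp: t_def intro!: prod_le_1 prod_nonneg)
    have A: "A a j \<subseteq> S" if "a \<in> F" for a using assms(4) that Suc by auto
    have BS: "B p j a \<subseteq> S" if "a \<in> F" for a by (auto simp: B_def)
    obtain \<pi> where \<pi>: "\<pi> permutes S"
      "(\<Sum>a\<in>F. w a * t a ^ card (B p j a \<inter> \<pi> ` A a j))
      \<le> (\<Sum>a\<in>F. w a * (1 - (1 - t a) * (card (A a j) / card S)) ^ card (B p j a))"
      using ex_permutation_below_average[of S F w t "\<lambda>a. A a j" "B p j"] assms t A BS by blast
    have "(1 - t a) * (card (A a j) / card S) = (\<Prod>i\<in>{j..<k}. \<mu> a i)" for a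
      using Suc by (simp add: t_def \<mu>_def prod.atLeast_Suc_lessThan)
    moreover have "B (p(j := \<pi>)) (Suc j) a = B p j a \<inter> \<pi> ` A a j" for a
      by (auto simp: B_def less_Suc_eq)
    moreover have "\<forall>i<Suc j. (p(j := \<pi>)) i permutes S"
      using p \<pi> by (simp add: less_Suc_eq)
    ultimately show ?case
      using p \<pi> unfolding t_def by (intro exI[of _ "p(j := \<pi>)"]) (simp del: fun_upd_apply)
  qed
  \<comment> \<open>At \<open>j = k\<close> the empty product makes the base 0, and
    \<open>0 ^ 0 = 1\<close> turns the power into the indicator that no common label exists.\<close>
  from this[of k] obtain p where p: "\<forall>i<k. p i permutes S"
    "(\<Sum>a\<in>F. w a * 0 ^ card (B p k a)) \<le> (\<Sum>a\<in>F. w a * (1 - (\<Prod>i<k. \<mu> a i)) ^ card S)"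
    by auto
  have fB: "finite (B p k a)" for a using assms(1) by (simp add: B_def)
  have "(\<Sum>a | a \<in> F \<and> B p k a = {}. w a) = (\<Sum>a\<in>F. w a * of_bool (B p k a = {}))"
    using assms(5) by (simp add: Int_def)
  also have "\<dots> = (\<Sum>a\<in>F. w a * 0 ^ card (B p k a))"
    using fB by (intro sum.cong) (auto simp: power_0_left)
  finally show ?thesis using p unfolding \<mu>_def B_def by auto
qed

section \<open>Assembling a scheme from labelled branches\<close>

text \<open>Branch \<open>i\<close> below the root is a copy of the smaller tree, with \<open>i\<close> prepended to its words;
  \<open>r\<close> labels the leaves at the root and \<open>f i\<close> those at its \<open>i\<close>-th child.\<close>

definition graft :: "(node \<Rightarrow> nat) \<Rightarrow> (nat \<Rightarrow> node \<Rightarrow> nat) \<Rightarrow> (node \<Rightarrow> node \<Rightarrow> nat) \<Rightarrow> node \<Rightarrow> node \<Rightarrow> nat"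
  where "graft r f \<beta> v w =
    (case v of [] \<Rightarrow> r w | i # u \<Rightarrow> if u = [] then f i (tl w) else \<beta> u (tl w))"

definition branch :: "node set \<Rightarrow> nat \<Rightarrow> node set" where
  "branch A i = {w. i # w \<in> A}"

definition free_sets :: "nat \<Rightarrow> nat \<Rightarrow> (node \<Rightarrow> node \<Rightarrow> nat) \<Rightarrow> node set set" where
  "free_sets k d \<beta> = {A. A \<subseteq> leaves (full_tree k d) \<and> \<not> has_collision k d A \<beta>}"

lemma finite_leaves_full_tree: "finite (leaves (full_tree k d))"
  by (rule finite_subset[OF _ finite_lists_length_le[of "{..<k}" d]])
    (auto simp: leaves_def full_tree_def)

lemma finite_free_sets: "finite (free_sets k d \<beta>)"
  by (rule finite_subset[of _ "Pow (leaves (full_tree k d))"])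
    (auto simp: free_sets_def finite_leaves_full_tree)

lemma leaves_subtree_Cons:
  assumes "i < k"
  shows "leaves (subtree (full_tree k (Suc d)) (i # u))
    = (#) i ` leaves (subtree (full_tree k d) u)"
proof -
  have k: "k \<ge> 1" using assms by simp
  show ?thesis
    using assms
    by (auto simp: leaves_subtree_full_tree leaves_full_tree[OF k] prefix_def length_Suc_conv
        image_iff)
qed

lemma scheme_graft:
  assumes k: "k \<ge> 1" and \<beta>: "scheme k d \<beta>"
    and r: "bij_betw r (leaves (full_tree k (Suc d))) {1..k ^ Suc d}"
    and f: "\<And>i. i < k \<Longrightarrow> bij_betw (f i) (leaves (full_tree k d)) {1..k ^ d}"
  shows "scheme k (Suc d) (graft r f \<beta>)"
  unfolding scheme_def
proof
  fix v assume v: "v \<in> full_tree k (Suc d)"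
  show "bij_betw (graft r f \<beta> v) (leaves (subtree (full_tree k (Suc d)) v))
          {1..card (leaves (subtree (full_tree k (Suc d)) v))}"
  proof (cases v)
    case Nil
    then have "graft r f \<beta> v = r" by (auto simp: graft_def)
    then show ?thesis
      using r card_leaves_full_tree[OF k, of "Suc d"] Nil by (simp add: leaves_subtree_full_tree)
  next
    case (Cons i u)
    then have i: "i < k" and u: "u \<in> full_tree k d" using v by (auto simp: full_tree_def)
    define L where "L = leaves (subtree (full_tree k d) u)"
    define g where "g = (if u = [] then f i else \<beta> u)"
    have "bij_betw g L {1..card L}"
      using \<beta> u f[OF i] card_leaves_full_tree[OF k, of d]
      by (auto simp: g_def L_def scheme_def leaves_subtree_full_tree)
    moreover have "bij_betw tl ((#) i ` L) L" by (auto simp: bij_betw_def inj_on_def image_iff)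
    ultimately have "bij_betw (g \<circ> tl) ((#) i ` L) {1..card L}" using bij_betw_trans by blast
    moreover have "graft r f \<beta> v = g \<circ> tl" by (auto simp: graft_def Cons g_def)
    ultimately show ?thesis
      by (simp add: Cons leaves_subtree_Cons[OF i] L_def card_image)
  qed
qed

lemma forms_collisionI:
  assumes "\<And>i. i \<in> {1..k} \<Longrightarrow> a i \<in> A \<and> c i \<in> children (full_tree k d) u \<and> prefix (c i) (a i)"
    and "inj_on c {1..k}"
    and "\<And>i j. i \<in> {1..k} \<Longrightarrow> j \<in> {1..k} \<Longrightarrow> \<beta> (c i) (a i) = \<beta> (c j) (a j)"
  shows "forms_collision k d A \<beta> u"
  unfolding forms_collision_def
proof (rule exI, rule exI, intro conjI ballI)
  fix i j assume "i \<in> {1..k}" "j \<in> {1..k}"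
  then show "\<beta> (c i) (a i) = \<beta> (c j) (a j)" by (rule assms(3))
qed (use assms(1,2) in auto)

text \<open>Prepending \<open>i\<close> carries a collision of the branch at \<open>u\<close> to one
  of \<open>A\<close> at \<open>i # u\<close>. Collisions compare labels at children of
  \<open>u\<close>, which are nonempty words, so \<open>graft\<close> reads \<open>\<beta>\<close>
  there and never \<open>f i\<close>.\<close>

lemma branch_free:
  assumes "A \<in> free_sets k (Suc d) (graft r f \<beta>)" "i < k"
  shows "branch A i \<in> free_sets k d \<beta>"
proof -
  have k: "k \<ge> 1" using assms by simp
  have "branch A i \<subseteq> leaves (full_tree k d)"
    using assms by (fastforce simp: branch_def free_sets_def leaves_full_tree[OF k])
  moreover have "has_collision k (Suc d) A (graft r f \<beta>)" if collision: "has_collision k d (branch A i) \<beta>"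
  proof -
    obtain u where u: "u \<in> full_tree k d" and "forms_collision k d (branch A i) \<beta> u"
      using collision unfolding has_collision_def by blast
    then obtain a c where
      ac: "\<forall>j\<in>{1..k}. a j \<in> branch A i \<and> c j \<in> children (full_tree k d) u \<and> prefix (c j) (a j)"
      and c: "inj_on c {1..k}"
      and eq: "\<forall>j\<in>{1..k}. \<forall>l\<in>{1..k}. \<beta> (c j) (a j) = \<beta> (c l) (a l)"
      unfolding forms_collision_def by (elim exE conjE)
    have "c j \<noteq> []" if "j \<in> {1..k}" for j
      using bspec[OF ac that] by (auto simp: children_def)
    then have graft_branch: "graft r f \<beta> (i # c j) (i # a j) = \<beta> (c j) (a j)" if "j \<in> {1..k}" for j
      using that by (simp add: graft_def)
    have "forms_collision k (Suc d) A (graft r f \<beta>) (i # u)"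
    proof (rule forms_collisionI)
      fix j assume j: "j \<in> {1..k}"
      show "i # a j \<in> A \<and> i # c j \<in> children (full_tree k (Suc d)) (i # u)
          \<and> prefix (i # c j) (i # a j)"
        using bspec[OF ac j] assms(2) by (auto simp: branch_def children_def full_tree_def)
      fix l assume l: "l \<in> {1..k}"
      show "graft r f \<beta> (i # c j) (i # a j) = graft r f \<beta> (i # c l) (i # a l)"
        using bspec[OF bspec[OF eq j] l] by (simp only: graft_branch j l)
    next
      show "inj_on (\<lambda>j. i # c j) {1..k}"
        by (intro inj_onI inj_onD[OF c]) (simp_all only: list.inject)
    qed
    moreover have "i # u \<in> full_tree k (Suc d)" using u assms(2) by (auto simp: full_tree_def)
    ultimately show ?thesis unfolding has_collision_def by (rule bexI)
  qed
  ultimately show ?thesis using assms by (auto simp: free_sets_def)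
qed

text \<open>Since \<open>f i\<close> is the labelling at the child \<open>[i]\<close>, a label
  shared by all branches is a collision at the root.\<close>

lemma root_disjoint:
  assumes "A \<in> free_sets k (Suc d) (graft r f \<beta>)"
  shows "\<not> (\<forall>i<k. y \<in> f i ` branch A i)"
proof
  assume "\<forall>i<k. y \<in> f i ` branch A i"
  then have "\<forall>i. \<exists>w. i < k \<longrightarrow> i # w \<in> A \<and> f i w = y" by (auto simp: branch_def)
  then obtain w where w: "\<And>i. i < k \<Longrightarrow> i # w i \<in> A \<and> f i (w i) = y" by metis
  \<comment> \<open>Collisions are indexed by \<open>{1..k}\<close>, letters by
    \<open>{..<k}\<close>, hence the shift.\<close>
  define a where "a i = (i - 1) # w (i - 1)" for i
  define c where "c i = [i - 1]" for i :: nat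
  have "forms_collision k (Suc d) A (graft r f \<beta>) []"
  proof (rule forms_collisionI)
    show "inj_on c {1..k}" by (auto simp: inj_on_def c_def)
  next
    fix i assume "i \<in> {1..k}"
    then have i: "i - 1 < k" by auto
    show "a i \<in> A \<and> c i \<in> children (full_tree k (Suc d)) [] \<and> prefix (c i) (a i)"
      using i w[OF i] by (auto simp: a_def c_def children_def full_tree_def)
    fix j assume "j \<in> {1..k}"
    then have j: "j - 1 < k" by auto
    show "graft r f \<beta> (c i) (a i) = graft r f \<beta> (c j) (a j)"
      using w[OF i] w[OF j] by (simp add: a_def c_def graft_def)
  qed
  then have "has_collision k (Suc d) A (graft r f \<beta>)"
    unfolding has_collision_def by (rule bexI) (simp add: full_tree_def)
  then show False using assms by (simp add: free_sets_def)
qed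

lemma Un_branches:
  assumes "A \<subseteq> leaves (full_tree k (Suc d))" "k \<ge> 1"
  shows "A = (\<Union>i<k. (#) i ` branch A i)"
proof
  show "A \<subseteq> (\<Union>i<k. (#) i ` branch A i)"
  proof
    fix v assume v: "v \<in> A"
    then have "set v \<subseteq> {..<k}" "length v = Suc d"
      using assms by (auto simp: leaves_full_tree[OF assms(2)])
    then obtain i w where "v = i # w" "i < k" by (cases v) auto
    then show "v \<in> (\<Union>i<k. (#) i ` branch A i)" using v by (auto simp: branch_def)
  qed
qed (auto simp: branch_def)

lemma card_branches:
  assumes "A \<subseteq> leaves (full_tree k (Suc d))" "k \<ge> 1"
  shows "card A = (\<Sum>i<k. card (branch A i))"
proof -
  have "finite A" using assms(1) finite_leaves_full_tree finite_subset by blast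
  then have fin: "finite (branch A i)" for i
    unfolding branch_def by (rule finite_inverse_image) (auto simp: inj_on_def)
  have "card A = card (\<Union>i<k. (#) i ` branch A i)" using Un_branches[OF assms] by simp
  also have "\<dots> = (\<Sum>i<k. card ((#) i ` branch A i))"
    using fin by (intro card_UN_disjoint) auto
  also have "\<dots> = (\<Sum>i<k. card (branch A i))" by (simp add: card_image)
  finally show ?thesis .
qed

section \<open>Total weight of collision-free sets, by induction on the depth\<close>

definition weight :: "nat \<Rightarrow> nat \<Rightarrow> nat \<Rightarrow> real" where
  "weight k d m = exp (real k ^ d * ((4 * k + d) / k * (m / real k ^ d) ^ k - 5))"

text \<open>The second factor is at most \<open>exp (- N * (\<Prod>i<k. x i))\<close>. At depth
  \<open>Suc d\<close> the coefficient is \<open>c + 1\<close> and there are \<open>k * N\<close>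
  leaves, so the exponents compare by \<open>N\<close> times \<open>power_mean_plus_prod\<close>,
  and the constants \<open>- 5\<close> add up exactly.\<close>

lemma weight_step:
  fixes m :: "nat \<Rightarrow> nat"
  assumes k: "k \<ge> 2" and m: "\<And>i. i < k \<Longrightarrow> m i \<le> k ^ d"
  shows "weight k (Suc d) (\<Sum>i<k. m i) * (1 - (\<Prod>i<k. m i / real k ^ d)) ^ (k ^ d)
    \<le> (\<Prod>i<k. weight k d (m i))"
proof -
  define N where "N = real k ^ d"
  define x where "x i = m i / N" for i
  define c where "c = real (4 * k + d)"
  define M where "M = (\<Sum>i<k. m i) / (k * N)"
  have N: "N > 0" using k by (simp add: N_def)
  have x: "0 \<le> x i" "x i \<le> 1" if "i < k" for i
    using m[OF that] N by (auto simp: x_def N_def simp flip: of_nat_power)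
  have P: "0 \<le> (\<Prod>i<k. x i)" "(\<Prod>i<k. x i) \<le> 1"
    using x by (auto intro!: prod_nonneg prod_le_1)
  have "k * M = (\<Sum>i<k. x i)"
    using k N by (simp add: M_def x_def flip: sum_divide_distrib)
  then have "(c + 1) * M ^ k \<le> c / k * (\<Sum>i<k. x i ^ k) + (\<Prod>i<k. x i)"
    using x k by (intro power_mean_plus_prod) (auto simp: c_def)
  then have "N * ((c + 1) * M ^ k - 5 * k - (\<Prod>i<k. x i)) \<le> N * (c / k * (\<Sum>i<k. x i ^ k) - 5 * k)"
    using N by (intro mult_left_mono) auto
  also have "\<dots> = (\<Sum>i<k. N * (c / k * x i ^ k - 5))"
    by (simp add: sum_subtractf sum_distrib_left right_diff_distrib)
  finally have exponent: "N * ((c + 1) * M ^ k - 5 * k - (\<Prod>i<k. x i))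
      \<le> (\<Sum>i<k. N * (c / k * x i ^ k - 5))" .
  have "(1 - (\<Prod>i<k. x i)) ^ (k ^ d) \<le> exp (- (\<Prod>i<k. x i)) ^ (k ^ d)"
    using P exp_ge_add_one_self[of "- (\<Prod>i<k. x i)"] by (intro power_mono) auto
  also have "\<dots> = exp (- N * (\<Prod>i<k. x i))"
    by (simp add: N_def flip: exp_of_nat_mult)
  finally have "weight k (Suc d) (\<Sum>i<k. m i) * (1 - (\<Prod>i<k. x i)) ^ (k ^ d)
      \<le> weight k (Suc d) (\<Sum>i<k. m i) * exp (- N * (\<Prod>i<k. x i))"
    by (intro mult_left_mono) (auto simp: weight_def)
  also have "\<dots> = exp (k * N * ((c + 1) / k * M ^ k - 5)) * exp (- N * (\<Prod>i<k. x i))"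
    by (simp add: weight_def N_def M_def c_def add_ac)
  also have "\<dots> = exp (N * ((c + 1) * M ^ k - 5 * k - (\<Prod>i<k. x i)))"
    using k by (simp add: field_simps flip: exp_add)
  also have "\<dots> \<le> exp (\<Sum>i<k. N * (c / k * x i ^ k - 5))" using exponent by simp
  also have "\<dots> = (\<Prod>i<k. weight k d (m i))"
    by (simp add: exp_sum weight_def N_def c_def x_def)
  finally show ?thesis unfolding x_def N_def by simp
qed

text \<open>A free set is determined by its branches, which are free and share no label at the root.
  After \<open>weight_step\<close> the sum over tuples of branches factorises into \<open>k\<close>
  copies of the sum for depth \<open>d\<close>, so the bound 1 is preserved.\<close>

lemma ex_scheme_total_weight:
  assumes k: "k \<ge> 2"
  shows "\<exists>\<beta>. scheme k d \<beta> \<and> (\<Sum>A\<in>free_sets k d \<beta>. weight k d (card A)) \<le> 1"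
proof (induction d)
  case 0
  define \<beta> :: "node \<Rightarrow> node \<Rightarrow> nat" where "\<beta> v w = 1" for v w
  have L: "leaves (full_tree k 0) = {[]}" using k by (auto simp: leaves_full_tree)
  have "scheme k 0 \<beta>"
    unfolding scheme_def leaves_subtree_full_tree L
    by (auto simp: \<beta>_def full_tree_def bij_betw_def Collect_conv_if)
  moreover have "(\<Sum>A\<in>free_sets k 0 \<beta>. weight k 0 (card A)) \<le> 1"
  proof -
    have "free_sets k 0 \<beta> \<subseteq> {{}, {[]}}" by (auto simp: free_sets_def L)
    then have "(\<Sum>A\<in>free_sets k 0 \<beta>. weight k 0 (card A))
        \<le> (\<Sum>A\<in>{{}, {[] :: node}}. weight k 0 (card A))"
      by (intro sum_mono2) (auto simp: weight_def)
    \<comment> \<open>For the single leaf the exponent is \<open>4 - 5\<close>.\<close>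
    also have "\<dots> = exp (- 5) + exp (- 1)" using k by (simp add: weight_def power_0_left)
    also have "\<dots> \<le> exp (- 1) + exp (- 1 :: real)" by simp
    also have "\<dots> \<le> 1" using exp_ge_add_one_self[of "1::real"] by (simp add: exp_minus field_simps)
    finally show ?thesis .
  qed
  ultimately show ?case by blast
next
  case (Suc d)
  then obtain \<beta> where \<beta>: "scheme k d \<beta>" "(\<Sum>A\<in>free_sets k d \<beta>. weight k d (card A)) \<le> 1"
    by blast
  have k1: "k \<ge> 1" using k by simp
  define L where "L = leaves (full_tree k d)"
  define S where "S = {1..k ^ d}"
  define F where "F = (\<Pi>\<^sub>E i\<in>{..<k}. free_sets k d \<beta>)"
  have S: "finite S" "S \<noteq> {}" "card S = k ^ d" using k by (auto simp: S_def)
  \<comment> \<open>One reference labelling turns sets of leaves into sets of labels, on which the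
    permutations act.\<close>
  obtain e where e: "bij_betw e L S"
    using card_leaves_full_tree[OF k1, of d] finite_leaves_full_tree[of k d] S
    by (metis L_def finite_same_card_bij)
  obtain r where r: "bij_betw r (leaves (full_tree k (Suc d))) {1..k ^ Suc d}"
    using card_leaves_full_tree[OF k1, of "Suc d"] finite_leaves_full_tree[of k "Suc d"]
    by (metis card_atLeastAtMost diff_Suc_1 finite_atLeastAtMost finite_same_card_bij)
  have sub: "a i \<subseteq> L" if "a \<in> F" "i < k" for a i
    using that by (auto simp: F_def free_sets_def L_def PiE_iff)
  have card_e: "card (e ` a i) = card (a i)" if "a \<in> F" "i < k" for a i
    using sub[OF that] e by (metis bij_betw_def card_image inj_on_subset)
  have card_le: "card (a i) \<le> k ^ d" if "a \<in> F" "i < k" for a i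
    using card_mono[OF _ sub[OF that]] finite_leaves_full_tree card_leaves_full_tree[OF k1]
    by (simp add: L_def)
  have finF: "finite F" unfolding F_def by (intro finite_PiE) (auto simp: finite_free_sets)
  have ewS: "e ` a i \<subseteq> S" if "a \<in> F" "i < k" for a i
    using sub[OF that] e by (auto simp: bij_betw_def)
  obtain p where p: "\<forall>i<k. p i permutes S"
    "(\<Sum>a | a \<in> F \<and> {y \<in> S. \<forall>i<k. y \<in> p i ` e ` a i} = {}.
        weight k (Suc d) (\<Sum>i<k. card (a i)))
      \<le> (\<Sum>a\<in>F. weight k (Suc d) (\<Sum>i<k. card (a i))
          * (1 - (\<Prod>i<k. card (e ` a i) / card S)) ^ card S)"
    using ex_permutations_few_disjoint[of S F "\<lambda>a. weight k (Suc d) (\<Sum>i<k. card (a i))" k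
        "\<lambda>a i. e ` a i"] S ewS finF by (auto simp: weight_def)
  define f where "f i = p i \<circ> e" for i
  define \<gamma> where "\<gamma> = graft r f \<beta>"
  have "bij_betw (f i) L S" if "i < k" for i
    using p(1) that e bij_betw_trans permutes_imp_bij unfolding f_def by blast
  then have "scheme k (Suc d) \<gamma>"
    unfolding \<gamma>_def using k1 \<beta>(1) r by (intro scheme_graft) (auto simp: L_def S_def)
  moreover have "(\<Sum>A\<in>free_sets k (Suc d) \<gamma>. weight k (Suc d) (card A)) \<le> 1"
  proof -
    \<comment> \<open>Restriction makes the tuple of branches an element of the extensional product
      \<open>F\<close>.\<close>
    define b where "b A = restrict (branch A) {..<k}" for A
    have inj: "inj_on b (free_sets k (Suc d) \<gamma>)"
    proof (rule inj_onI)
      fix A B assume AB: "A \<in> free_sets k (Suc d) \<gamma>" "B \<in> free_sets k (Suc d) \<gamma>" "b A = b B"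
      have "branch A i = branch B i" if "i < k" for i
        using fun_cong[OF AB(3), of i] that by (simp add: b_def)
      moreover have "A = (\<Union>i<k. (#) i ` branch A i)" "B = (\<Union>i<k. (#) i ` branch B i)"
        using AB k1 by (auto intro!: Un_branches simp: free_sets_def)
      ultimately show "A = B" by (metis (no_types, lifting) SUP_cong lessThan_iff)
    qed
    have "b A \<in> {a \<in> F. {y \<in> S. \<forall>i<k. y \<in> p i ` e ` a i} = {}}"
      if "A \<in> free_sets k (Suc d) \<gamma>" for A
    proof -
      have "b A \<in> F" using branch_free that by (auto simp: b_def F_def \<gamma>_def)
      moreover have "\<not> (\<forall>i<k. y \<in> p i ` e ` b A i)" for y
        using root_disjoint[of A k d r f \<beta> y] that
        by (auto simp: b_def \<gamma>_def f_def image_comp)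
      ultimately show ?thesis by auto
    qed
    then have img: "b ` free_sets k (Suc d) \<gamma>
        \<subseteq> {a \<in> F. {y \<in> S. \<forall>i<k. y \<in> p i ` e ` a i} = {}}" by blast
    have "(\<Sum>A\<in>free_sets k (Suc d) \<gamma>. weight k (Suc d) (card A))
        = (\<Sum>A\<in>free_sets k (Suc d) \<gamma>. weight k (Suc d) (\<Sum>i<k. card (b A i)))"
      using k1 by (intro sum.cong) (auto simp: b_def card_branches free_sets_def)
    also have "\<dots> = (\<Sum>a\<in>b ` free_sets k (Suc d) \<gamma>. weight k (Suc d) (\<Sum>i<k. card (a i)))"
      by (simp add: sum.reindex[OF inj])
    also have "\<dots> \<le> (\<Sum>a | a \<in> F \<and> {y \<in> S. \<forall>i<k. y \<in> p i ` e ` a i} = {}.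
        weight k (Suc d) (\<Sum>i<k. card (a i)))"
      using img finF by (intro sum_mono2) (auto simp: weight_def)
    also note p(2)
    also have "(\<Sum>a\<in>F. weight k (Suc d) (\<Sum>i<k. card (a i))
          * (1 - (\<Prod>i<k. card (e ` a i) / card S)) ^ card S)
        = (\<Sum>a\<in>F. weight k (Suc d) (\<Sum>i<k. card (a i))
          * (1 - (\<Prod>i<k. card (a i) / real k ^ d)) ^ (k ^ d))"
      using card_e by (simp add: S(3))
    also have "\<dots> \<le> (\<Sum>a\<in>F. \<Prod>i<k. weight k d (card (a i)))"
      by (intro sum_mono) (rule weight_step[OF k], simp add: card_le)
    also have "\<dots> = (\<Prod>i<k. \<Sum>A\<in>free_sets k d \<beta>. weight k d (card A))"
      unfolding F_def by (subst prod_sum_PiE) (auto simp: finite_free_sets)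
    also have "\<dots> \<le> 1"
      using \<beta>(2) by (intro prod_le_1) (auto simp: weight_def intro!: sum_nonneg)
    finally show ?thesis .
  qed
  ultimately show ?case by blast
qed

section \<open>The unary tree and the final estimate\<close>

lemma ex_scheme: "\<exists>\<beta>. scheme k d \<beta>"
proof -
  have "\<exists>f. bij_betw f (leaves (subtree (full_tree k d) v))
      {1..card (leaves (subtree (full_tree k d) v))}" for v
    by (intro finite_same_card_bij)
      (auto simp: leaves_subtree_full_tree finite_leaves_full_tree)
  then show ?thesis unfolding scheme_def by metis
qed

text \<open>For a single child, equality of labels is trivial: any leaf in \<open>A\<close> gives a
  collision at the root, and the density bound makes \<open>A\<close> nonempty.\<close>

lemma collision_unary:
  assumes "q_subset 1 d q A" "d \<ge> 1" "q \<ge> 1"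
  shows "has_collision 1 d A \<beta>"
proof -
  have "A \<noteq> {}" using assms by (auto simp: q_subset_def)
  then obtain a where a: "a \<in> A" by blast
  then have "set a \<subseteq> {..<1} \<and> length a = d"
    using assms(1) leaves_full_tree[of 1 d] by (auto simp: q_subset_def)
  then have "prefix [0] a" using assms(2) by (cases a) auto
  moreover have "[0] \<in> children (full_tree 1 d) []"
    using assms(2) by (auto simp: children_def full_tree_def)
  ultimately have "forms_collision 1 d A \<beta> []"
    using a by (intro forms_collisionI[of _ "\<lambda>_. a" _ "\<lambda>_. [0]"]) auto
  then show ?thesis unfolding has_collision_def by (rule bexI) (simp add: full_tree_def)
qed

theorem theorem11:
  fixes k d q :: nat
  assumes "k \<ge> 1" and "q \<ge> 1"
    and "real d \<ge> real k * (4 * real q) powr (4 * real k * log 2 (real k))"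
  shows "\<exists>\<beta>. scheme k d \<beta> \<and> (\<forall>A. q_subset k d q A \<longrightarrow> has_collision k d A \<beta>)"
proof (cases "k = 1")
  case True
  \<comment> \<open>The logarithm of 1 vanishes, so the hypothesis reads
    \<open>d \<ge> 1\<close>.\<close>
  then have "d \<ge> 1" using assms(2,3) by simp
  then show ?thesis using True ex_scheme collision_unary assms(2) by blast
next
  case False
  then have k: "k \<ge> 2" using assms(1) by simp
  \<comment> \<open>For \<open>k \<ge> 2\<close> the logarithm is at least 1. With
    \<open>4 ^ k \<ge> 16\<close> absorbing the constant 5, the hypothesis yields
    \<open>d \<ge> 5 * k * q ^ k\<close>.\<close>
  have "real k \<le> 4 * real k * log 2 (real k)"
  proof -
    have "1 \<le> log 2 (real k)" using k by (simp add: le_log_iff)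
    then have "4 * real k * 1 \<le> 4 * real k * log 2 (real k)" by (intro mult_left_mono) auto
    then show ?thesis by simp
  qed
  then have "(4 * real q) powr real k \<le> (4 * real q) powr (4 * real k * log 2 (real k))"
    using assms(2) by (intro powr_mono) auto
  moreover have "(4 * real q) powr real k = 4 ^ k * real q ^ k"
    using assms(2) by (simp add: powr_realpow power_mult_distrib)
  moreover have "5 * real q ^ k \<le> 4 ^ k * real q ^ k"
  proof (intro mult_right_mono)
    have "(4::real) ^ 2 \<le> 4 ^ k" using k by (intro power_increasing) auto
    then show "(5::real) \<le> 4 ^ k" by simp
  qed simp
  ultimately have "real k * (5 * real q ^ k)
      \<le> real k * (4 * real q) powr (4 * real k * log 2 (real k))"
    by (intro mult_left_mono) linarith+
  then have d: "5 * real k * real q ^ k \<le> d" using assms(3) by simp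
  obtain \<beta> where \<beta>: "scheme k d \<beta>" "(\<Sum>A\<in>free_sets k d \<beta>. weight k d (card A)) \<le> 1"
    using ex_scheme_total_weight[OF k] by blast
  have "has_collision k d A \<beta>" if A: "q_subset k d q A" for A
  proof (rule ccontr)
    assume "\<not> has_collision k d A \<beta>"
    then have "A \<in> free_sets k d \<beta>" using A by (simp add: free_sets_def q_subset_def)
    then have "weight k d (card A) \<le> (\<Sum>A\<in>free_sets k d \<beta>. weight k d (card A))"
      by (intro member_le_sum) (auto simp: weight_def finite_free_sets)
    then have "weight k d (card A) \<le> 1" using \<beta>(2) by simp
    then have "(4 * k + d) / k * (card A / k ^ d) ^ k \<le> 5"
      using k by (simp add: weight_def mult_le_0_iff power_le_zero_eq)
    \<comment> \<open>The part with \<open>d\<close> gives at least 5; the summand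
      \<open>4 * k\<close> makes the inequality strict.\<close>
    moreover have "5 < (4 * k + d) / k * (1 / real q) ^ k"
      using d k assms(2) by (simp add: field_simps power_one_over)
    moreover have "(4 * k + d) / k * (1 / real q) ^ k \<le> (4 * k + d) / k * (card A / k ^ d) ^ k"
    proof (intro mult_left_mono power_mono)
      have "real k ^ d / real q \<le> card A" using A by (simp add: q_subset_def)
      then show "1 / real q \<le> card A / k ^ d" using k assms(2) by (simp add: field_simps)
    qed auto
    ultimately show False by linarith
  qed
  then show ?thesis using \<beta>(1) by blast
qed

end
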